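(* Let $I$ be an index-invariant $\sigma$-ideal over ${}^\omega 2$ containing all singletons. For every infinite cardinal $\kappa$ and every ultrafilter $U$ on $\mathbb{B}(I,\kappa)$, we have $\langle [\kappa]^{<\aleph_0},\subseteq\rangle\le_{\mathrm{T}}\langle U,\ge\rangle$.
   Context: A $\sigma$-ideal $I$ over ${}^\omega 2$ is index invariant if for every injective $\Delta\colon\omega\to\omega$ and every $X\subseteq{}^\omega 2$: $X\in I\iff\{f\in{}^\omega 2 : f\circ\Delta\in X\}\in I$. For an index-invariant $\sigma$-ideal $I$ and an infinite ordinal $\alpha$, let $I(\alpha)$ be the family of all $X\subseteq{}^\alpha 2$ for which there exist an injective $\Delta\colon\omega\to\alpha$ and $Y\in I$ such that $f\circ\Delta\in Y$ for all $f\in X$ (this is a $\sigma$-ideal over ${}^\alpha 2$). Let $\mathcal{B}({}^\alpha 2)$ be the $\sigma$-algebra of subsets of ${}^\alpha 2$ generated by the clopen subsets of the Cantor space ${}^\alpha 2$, and let $\mathbb{B}(I,\alpha)=\mathcal{B}({}^\alpha 2)/I(\alpha)$ be the quotient $\sigma$-algebra. $[\kappa]^{<\aleph_0}$ is the set of finite subsets of $\kappa$. For directed sets $\langle D,\le^D\rangle$, $\langle E,\le^E\rangle$, write $D\le_{\mathrm{T}}E$ (Tukey reducibility) if there are functions $f\colon D\to E$ and $g\colon E\to D$ such that for all $d\in D$, $e\in E$: $f(d)\le^E e\implies d\le^D g(e)$. An ultrafilter $U$ on a Boolean algebra is regarded as the directed set $\langle U,\ge\rangle$, i.e. ordered by reverse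 Boolean order. *)

theory Defs
  imports "HOL-Analysis.Analysis" "HOL-Algebra.Lattice"
begin

section \<open>Tukey reducibility\<close>

definition tukey_le :: "'a set \<Rightarrow> ('a \<Rightarrow> 'a \<Rightarrow> bool) \<Rightarrow> 'b set \<Rightarrow> ('b \<Rightarrow> 'b \<Rightarrow> bool) \<Rightarrow> bool" where
  "tukey_le D leD E leE \<longleftrightarrow>
     (\<exists>f\<in>D \<rightarrow> E. \<exists>g\<in>E \<rightarrow> D. \<forall>d\<in>D. \<forall>e\<in>E. leE (f d) e \<longrightarrow> leD d (g e))"

section \<open>Quotient algebras and ultrafilters\<close>

definition sigma_ideal :: "'a set \<Rightarrow> 'a set set \<Rightarrow> bool" where
  "sigma_ideal \<Omega> J \<longleftrightarrow>
     J \<subseteq> Pow \<Omega> \<and> {} \<in> J \<and> (\<forall>X\<in>J. \<forall>Y. Y \<subseteq> X \<longrightarrow> Y \<in> J) \<and>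
     (\<forall>F :: nat \<Rightarrow> 'a set. range F \<subseteq> J \<longrightarrow> (\<Union>n. F n) \<in> J)"

text \<open>The ideal \<open>J\<close> need not consist of members of the algebra \<open>M\<close>; only \<open>J \<inter> M\<close> matters.\<close>

definition quot_rel :: "'a set set \<Rightarrow> 'a set set \<Rightarrow> ('a set \<times> 'a set) set" where
  "quot_rel M J = {(X, Y). X \<in> M \<and> Y \<in> M \<and> sym_diff X Y \<in> J}"

definition quot_class :: "'a set set \<Rightarrow> 'a set set \<Rightarrow> 'a set \<Rightarrow> 'a set set" where
  "quot_class M J X = quot_rel M J `` {X}"

text \<open>A Boolean algebra is represented by its order. For the quotient, \<open>[X] \<le> [Y]\<close> iff
  \<open>X - Y\<close> is in the ideal, independently of the representatives; see \<open>quot_le_iff\<close> and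
  \<open>quot_boolean\<close> below.\<close>

definition quotient_algebra :: "'a set set \<Rightarrow> 'a set set \<Rightarrow> 'a set set gorder" where
  "quotient_algebra M J =
     \<lparr>carrier = M // quot_rel M J, eq = (=),
      le = (\<lambda>a b. \<exists>X\<in>a. \<exists>Y\<in>b. X - Y \<in> J)\<rparr>"

definition is_complement :: "('a, 'c) gorder_scheme \<Rightarrow> 'a \<Rightarrow> 'a \<Rightarrow> bool" where
  "is_complement L a c \<longleftrightarrow>
     a \<in> carrier L \<and> c \<in> carrier L \<and> a \<sqinter>\<^bsub>L\<^esub> c = \<bottom>\<^bsub>L\<^esub> \<and> a \<squnion>\<^bsub>L\<^esub> c = \<top>\<^bsub>L\<^esub>"

definition boolean_lattice :: "('a, 'c) gorder_scheme \<Rightarrow> bool" where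
  "boolean_lattice L \<longleftrightarrow> bounded_lattice L \<and>
     (\<forall>a\<in>carrier L. \<forall>b\<in>carrier L. \<forall>c\<in>carrier L.
        a \<sqinter>\<^bsub>L\<^esub> (b \<squnion>\<^bsub>L\<^esub> c) = (a \<sqinter>\<^bsub>L\<^esub> b) \<squnion>\<^bsub>L\<^esub> (a \<sqinter>\<^bsub>L\<^esub> c)) \<and>
     (\<forall>a\<in>carrier L. \<exists>c. is_complement L a c)"

definition ultrafilter_on :: "('a, 'c) gorder_scheme \<Rightarrow> 'a set \<Rightarrow> bool" where
  "ultrafilter_on L U \<longleftrightarrow>
     U \<subseteq> carrier L \<and> \<top>\<^bsub>L\<^esub> \<in> U \<and> \<bottom>\<^bsub>L\<^esub> \<notin> U \<and>
     (\<forall>a\<in>U. \<forall>b\<in>U. a \<sqinter>\<^bsub>L\<^esub> b \<in> U) \<and>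
     (\<forall>a\<in>U. \<forall>b\<in>carrier L. a \<sqsubseteq>\<^bsub>L\<^esub> b \<longrightarrow> b \<in> U) \<and>
     (\<forall>a c. is_complement L a c \<longrightarrow> a \<in> U \<or> c \<in> U)"

subsection \<open>The quotient by a \<open>\<sigma>\<close>-ideal is a Boolean algebra\<close>

lemma sigma_ideal_Un:
  assumes "sigma_ideal \<Omega> J" "X \<in> J" "Y \<in> J"
  shows "X \<union> Y \<in> J"
proof -
  let ?F = "\<lambda>n::nat. if n = 0 then X else Y"
  have "range ?F \<subseteq> J" using assms by auto
  then have "(\<Union>n. ?F n) \<in> J" using assms(1) unfolding sigma_ideal_def by blast
  moreover have "(\<Union>n. ?F n) = X \<union> Y" by (auto split: if_splits)
  ultimately show ?thesis by simp
qed

lemma sigma_ideal_subset: "sigma_ideal \<Omega> J \<Longrightarrow> X \<in> J \<Longrightarrow> Y \<subseteq> X \<Longrightarrow> Y \<in> J"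
  unfolding sigma_ideal_def by blast

context
  fixes \<Omega> :: "'a set" and M J
  assumes M: "sigma_algebra \<Omega> M" and J: "sigma_ideal \<Omega> J"
begin

interpretation sigma_algebra \<Omega> M by (rule M)

lemma diff_trans: "X - Y \<in> J \<Longrightarrow> Y - Z \<in> J \<Longrightarrow> X - Z \<in> J"
  by (rule sigma_ideal_subset[OF J sigma_ideal_Un[OF J, of "X - Y" "Y - Z"]]) auto

lemma sym_diff_iff: "sym_diff X Y \<in> J \<longleftrightarrow> X - Y \<in> J \<and> Y - X \<in> J"
  using sigma_ideal_Un[OF J] sigma_ideal_subset[OF J] by (metis Un_upper1 Un_upper2)

lemma quot_rel_equiv: "equiv M (quot_rel M J)"
proof (rule equivI)
  show "quot_rel M J \<subseteq> M \<times> M" by (auto simp: quot_rel_def)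
  show "refl_on M (quot_rel M J)"
    using J by (auto simp: quot_rel_def refl_on_def sigma_ideal_def)
  show "sym (quot_rel M J)" by (auto simp: quot_rel_def sym_def Un_commute)
  show "trans (quot_rel M J)"
    unfolding quot_rel_def trans_def sym_diff_iff using diff_trans by blast
qed

lemma quot_class_self: "X \<in> M \<Longrightarrow> X \<in> quot_class M J X"
  unfolding quot_class_def by (rule equiv_class_self[OF quot_rel_equiv])

lemma quot_le_iff:
  assumes "X \<in> M" "Y \<in> M"
  shows "quot_class M J X \<sqsubseteq>\<^bsub>quotient_algebra M J\<^esub> quot_class M J Y \<longleftrightarrow> X - Y \<in> J"
proof
  assume "quot_class M J X \<sqsubseteq>\<^bsub>quotient_algebra M J\<^esub> quot_class M J Y"
  then obtain X' Y' where "X - X' \<in> J" "X' - Y' \<in> J" "Y' - Y \<in> J"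
    by (auto simp: quotient_algebra_def quot_class_def quot_rel_def sym_diff_iff)
  then show "X - Y \<in> J" by (blast intro: diff_trans)
next
  assume "X - Y \<in> J"
  moreover have "X \<in> quot_class M J X" "Y \<in> quot_class M J Y"
    using quot_class_self assms by auto
  ultimately show "quot_class M J X \<sqsubseteq>\<^bsub>quotient_algebra M J\<^esub> quot_class M J Y"
    unfolding quotient_algebra_def by auto
qed

lemma quot_eq_iff:
  assumes "X \<in> M" "Y \<in> M"
  shows "quot_class M J X = quot_class M J Y \<longleftrightarrow> X - Y \<in> J \<and> Y - X \<in> J"
  using assms eq_equiv_class_iff[OF quot_rel_equiv assms] sym_diff_iff[of X Y]
  by (auto simp: quot_class_def quot_rel_def)

lemma quot_carrier: "carrier (quotient_algebra M J) = (\<lambda>X. quot_class M J X) ` M"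
  by (auto simp: quotient_algebra_def quot_class_def quotient_def)

lemma quot_partial_order: "partial_order (quotient_algebra M J)"
proof
  have eq: "eq (quotient_algebra M J) = (=)" by (simp add: quotient_algebra_def)
  then show "(.=\<^bsub>quotient_algebra M J\<^esub>) = (=)" .
  fix a b c d assume "a \<in> carrier (quotient_algebra M J)" "b \<in> carrier (quotient_algebra M J)"
  then obtain X Y where XY: "X \<in> M" "Y \<in> M"
    "a = quot_class M J X" "b = quot_class M J Y" by (auto simp: quot_carrier)
  show "a \<sqsubseteq>\<^bsub>quotient_algebra M J\<^esub> a"
    using XY J by (simp add: quot_le_iff) (simp add: sigma_ideal_def)
  show "a .=\<^bsub>quotient_algebra M J\<^esub> b"
    if "a \<sqsubseteq>\<^bsub>quotient_algebra M J\<^esub> b" "b \<sqsubseteq>\<^bsub>quotient_algebra M J\<^esub> a"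
    using that XY by (simp add: eq quot_le_iff quot_eq_iff)
  show "a \<sqsubseteq>\<^bsub>quotient_algebra M J\<^esub> c"
    if "a \<sqsubseteq>\<^bsub>quotient_algebra M J\<^esub> b" "b \<sqsubseteq>\<^bsub>quotient_algebra M J\<^esub> c"
      and c: "c \<in> carrier (quotient_algebra M J)"
  proof -
    obtain Z where "Z \<in> M" "c = quot_class M J Z" using c by (auto simp: quot_carrier)
    then show ?thesis using that(1,2) XY by (auto simp: quot_le_iff intro: diff_trans)
  qed
qed (auto simp: quotient_algebra_def)

interpretation Q: partial_order "quotient_algebra M J" by (rule quot_partial_order)

lemma diff_empty: "X \<subseteq> Y \<Longrightarrow> X - Y \<in> J"
  using J by (auto simp: sigma_ideal_def Diff_eq_empty_iff[THEN iffD2])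

lemma quot_sup:
  assumes "X \<in> M" "Y \<in> M"
  shows "least (quotient_algebra M J) (quot_class M J (X \<union> Y))
    (Upper (quotient_algebra M J) {quot_class M J X, quot_class M J Y})"
proof (rule least_UpperI)
  fix y assume "y \<in> Upper (quotient_algebra M J) {quot_class M J X, quot_class M J Y}"
  moreover have "quot_class M J X \<in> carrier (quotient_algebra M J)"
    "quot_class M J Y \<in> carrier (quotient_algebra M J)"
    using assms by (auto simp: quot_carrier)
  ultimately have y: "y \<in> carrier (quotient_algebra M J)"
    "quot_class M J X \<sqsubseteq>\<^bsub>quotient_algebra M J\<^esub> y"
    "quot_class M J Y \<sqsubseteq>\<^bsub>quotient_algebra M J\<^esub> y"
    unfolding Upper_def by blast+
  then obtain Z where Z: "Z \<in> M" "y = quot_class M J Z" unfolding quot_carrier by blast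
  then have "X - Z \<in> J" "Y - Z \<in> J" using y assms by (simp_all add: quot_le_iff)
  with Z show "quot_class M J (X \<union> Y) \<sqsubseteq>\<^bsub>quotient_algebra M J\<^esub> y"
    using assms sigma_ideal_Un[OF J] by (simp add: quot_le_iff Un_Diff Un)
qed (use assms in \<open>auto simp: quot_le_iff quot_carrier Un Int intro!: diff_empty\<close>)

lemma quot_inf:
  assumes "X \<in> M" "Y \<in> M"
  shows "greatest (quotient_algebra M J) (quot_class M J (X \<inter> Y))
    (Lower (quotient_algebra M J) {quot_class M J X, quot_class M J Y})"
proof (rule greatest_LowerI)
  fix y assume "y \<in> Lower (quotient_algebra M J) {quot_class M J X, quot_class M J Y}"
  moreover have "quot_class M J X \<in> carrier (quotient_algebra M J)"
    "quot_class M J Y \<in> carrier (quotient_algebra M J)"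
    using assms by (auto simp: quot_carrier)
  ultimately have y: "y \<in> carrier (quotient_algebra M J)"
    "y \<sqsubseteq>\<^bsub>quotient_algebra M J\<^esub> quot_class M J X"
    "y \<sqsubseteq>\<^bsub>quotient_algebra M J\<^esub> quot_class M J Y"
    unfolding Lower_def by blast+
  then obtain Z where Z: "Z \<in> M" "y = quot_class M J Z" unfolding quot_carrier by blast
  then have "Z - X \<in> J" "Z - Y \<in> J" using y assms by (simp_all add: quot_le_iff)
  with Z show "y \<sqsubseteq>\<^bsub>quotient_algebra M J\<^esub> quot_class M J (X \<inter> Y)"
    using assms sigma_ideal_Un[OF J] by (simp add: quot_le_iff Diff_Int Int)
qed (use assms in \<open>auto simp: quot_le_iff quot_carrier Un Int intro!: diff_empty\<close>)

lemma quot_bottom: "least (quotient_algebra M J) (quot_class M J {}) (carrier (quotient_algebra M J))"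
  using diff_empty[of "{}"] by (auto simp: least_def quot_carrier quot_le_iff)

lemma quot_top: "greatest (quotient_algebra M J) (quot_class M J \<Omega>) (carrier (quotient_algebra M J))"
  using sets_into_space by (auto simp: greatest_def quot_carrier quot_le_iff intro!: diff_empty)

lemma quot_bounded_lattice: "bounded_lattice (quotient_algebra M J)"
proof
  fix x y assume "x \<in> carrier (quotient_algebra M J)" "y \<in> carrier (quotient_algebra M J)"
  then show "\<exists>s. least (quotient_algebra M J) s (Upper (quotient_algebra M J) {x, y})"
    "\<exists>s. greatest (quotient_algebra M J) s (Lower (quotient_algebra M J) {x, y})"
    unfolding quot_carrier using quot_sup quot_inf by blast+
qed (use quot_bottom quot_top in blast)+

interpretation Q: bounded_lattice "quotient_algebra M J" by (rule quot_bounded_lattice)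

lemma quot_join:
  assumes "X \<in> M" "Y \<in> M"
  shows "quot_class M J X \<squnion>\<^bsub>quotient_algebra M J\<^esub> quot_class M J Y = quot_class M J (X \<union> Y)"
  using Q.least_unique[OF _ quot_sup[OF assms]] someI[of "\<lambda>s. least (quotient_algebra M J) s _", OF quot_sup[OF assms]]
  unfolding join_def sup_def by blast

lemma quot_meet:
  assumes "X \<in> M" "Y \<in> M"
  shows "quot_class M J X \<sqinter>\<^bsub>quotient_algebra M J\<^esub> quot_class M J Y = quot_class M J (X \<inter> Y)"
  using Q.greatest_unique[OF _ quot_inf[OF assms]] someI[of "\<lambda>s. greatest (quotient_algebra M J) s _", OF quot_inf[OF assms]]
  unfolding meet_def inf_def by blast

lemma quot_bottom_eq: "\<bottom>\<^bsub>quotient_algebra M J\<^esub> = quot_class M J {}"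
  using Q.least_unique[OF _ quot_bottom] someI[of "\<lambda>s. least (quotient_algebra M J) s _", OF quot_bottom]
  unfolding bottom_def by blast

lemma quot_top_eq: "\<top>\<^bsub>quotient_algebra M J\<^esub> = quot_class M J \<Omega>"
  using Q.greatest_unique[OF _ quot_top] someI[of "\<lambda>s. greatest (quotient_algebra M J) s _", OF quot_top]
  unfolding top_def by blast

lemma quot_boolean: "boolean_lattice (quotient_algebra M J)"
  unfolding boolean_lattice_def
proof (intro conjI ballI)
  fix a assume "a \<in> carrier (quotient_algebra M J)"
  then obtain X where X: "X \<in> M" "a = quot_class M J X" by (auto simp: quot_carrier)
  then have "X \<union> (\<Omega> - X) = \<Omega>" using sets_into_space by auto
  then have "is_complement (quotient_algebra M J) a (quot_class M J (\<Omega> - X))"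
    using X by (simp add: is_complement_def quot_carrier quot_meet quot_join quot_bottom_eq quot_top_eq compl_sets del: Un_Diff_cancel)
  then show "\<exists>c. is_complement (quotient_algebra M J) a c" ..
qed (use Un Int in \<open>force simp: quot_bounded_lattice quot_carrier quot_meet quot_join Int_Un_distrib\<close>)+

end

section \<open>Index-invariant ideals on Cantor spaces\<close>

definition index_invariant :: "(nat \<Rightarrow> bool) set set \<Rightarrow> bool" where
  "index_invariant I \<longleftrightarrow>
     (\<forall>\<Delta> :: nat \<Rightarrow> nat. inj \<Delta> \<longrightarrow> (\<forall>X. X \<in> I \<longleftrightarrow> {f. f \<circ> \<Delta> \<in> X} \<in> I))"

text \<open>The order of an index set \<open>A\<close> (an infinite ordinal in the source) plays no role, so the
  Cantor space is indexed by an arbitrary set; its points are extensional functions.\<close>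

abbreviation cantor_points :: "'k set \<Rightarrow> ('k \<Rightarrow> bool) set" where
  "cantor_points A \<equiv> (\<Pi>\<^sub>E i\<in>A. UNIV)"

definition cantor_space :: "'k set \<Rightarrow> ('k \<Rightarrow> bool) topology" where
  "cantor_space A = product_topology (\<lambda>i. discrete_topology UNIV) A"

definition cantor_sets :: "'k set \<Rightarrow> ('k \<Rightarrow> bool) set set" where
  "cantor_sets A =
     sigma_sets (cantor_points A) {C. openin (cantor_space A) C \<and> closedin (cantor_space A) C}"

definition lift_ideal :: "(nat \<Rightarrow> bool) set set \<Rightarrow> 'k set \<Rightarrow> ('k \<Rightarrow> bool) set set" where
  "lift_ideal I A =
     {X. X \<subseteq> cantor_points A \<and>
         (\<exists>\<Delta> :: nat \<Rightarrow> 'k. inj \<Delta> \<and> range \<Delta> \<subseteq> A \<and> (\<exists>Y\<in>I. \<forall>f\<in>X. f \<circ> \<Delta> \<in> Y))}"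

definition cantor_algebra :: "(nat \<Rightarrow> bool) set set \<Rightarrow> 'k set \<Rightarrow> ('k \<Rightarrow> bool) set set gorder" where
  "cantor_algebra I A = quotient_algebra (cantor_sets A) (lift_ideal I A)"

subsection \<open>The ideal and the quotient are as claimed\<close>

lemma cantor_sets_sigma_algebra: "sigma_algebra (cantor_points A) (cantor_sets A)"
  unfolding cantor_sets_def
  by (rule sigma_algebra_sigma_sets)
    (use openin_subset[of "cantor_space A"] in \<open>auto simp: cantor_space_def\<close>)

lemma lift_ideal_sigma_ideal:
  fixes A :: "'k set"
  assumes I: "sigma_ideal UNIV I" "index_invariant I" and A: "infinite A"
  shows "sigma_ideal (cantor_points A) (lift_ideal I A)"
  unfolding sigma_ideal_def
proof (intro conjI ballI allI impI)
  show "lift_ideal I A \<subseteq> Pow (cantor_points A)" by (auto simp: lift_ideal_def)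
  obtain e :: "nat \<Rightarrow> 'k" where e: "inj e" "range e \<subseteq> A"
    using A infinite_countable_subset by blast
  then show "{} \<in> lift_ideal I A" using I(1) by (auto simp: lift_ideal_def sigma_ideal_def)
  show "Y \<in> lift_ideal I A" if "X \<in> lift_ideal I A" "Y \<subseteq> X" for X Y
    using that unfolding lift_ideal_def by blast
  fix F :: "nat \<Rightarrow> ('k \<Rightarrow> bool) set" assume F: "range F \<subseteq> lift_ideal I A"
  let ?P = "\<lambda>n \<Delta> Y. inj \<Delta> \<and> range \<Delta> \<subseteq> A \<and> Y \<in> I \<and> (\<forall>f\<in>F n. f \<circ> \<Delta> \<in> Y)"
  have Fn: "F n \<in> lift_ideal I A" for n using F by blast
  then have "\<exists>\<Delta> Y. ?P n \<Delta> Y" for n unfolding lift_ideal_def mem_Collect_eq by blast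
  then have "\<exists>D. \<forall>n. \<exists>Y. ?P n (D n) Y" by (intro choice allI)
  then obtain D where "\<forall>n. \<exists>Y. ?P n (D n) Y" ..
  then have "\<exists>Y. \<forall>n. ?P n (D n) (Y n)" by (rule choice)
  then obtain Y where P: "\<forall>n. ?P n (D n) (Y n)" ..
  have D: "F n \<subseteq> cantor_points A" "inj (D n)" "range (D n) \<subseteq> A" "Y n \<in> I"
    "f \<in> F n \<Longrightarrow> f \<circ> D n \<in> Y n" for n f
    using P Fn[of n] by (simp_all add: lift_ideal_def)
  define C where "C = (\<Union>n. range (D n))"
  have "infinite (range (D 0))" using D(2) by (rule range_inj_infinite)
  then have "infinite C" unfolding C_def by (rule contrapos_nn) (rule finite_subset[OF UN_upper[OF UNIV_I]])
  moreover have "countable C" unfolding C_def by auto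
  ultimately have G: "bij_betw (from_nat_into C) UNIV C" using bij_betw_from_nat_into by blast
  define G where "G = from_nat_into C"
  define H where "H n = inv G \<circ> D n" for n
  have GH: "G \<circ> H n = D n" for n
  proof
    fix x have "D n x \<in> range G" using G by (auto simp: bij_betw_def G_def C_def)
    then show "(G \<circ> H n) x = D n x" by (simp add: H_def f_inv_into_f)
  qed
  have inH: "inj (H n)" for n using D(2)[of n] unfolding GH[of n, symmetric] by (rule inj_on_imageI2)
  have "{f. f \<circ> H n \<in> Y n} \<in> I" for n
    using I(2)[unfolded index_invariant_def, rule_format, OF inH[of n], of "Y n"] D(4)[of n]
    by (rule iffD1)
  then have "range (\<lambda>n. {f. f \<circ> H n \<in> Y n}) \<subseteq> I" by blast
  then have 1: "(\<Union>n. {f. f \<circ> H n \<in> Y n}) \<in> I" using I(1) unfolding sigma_ideal_def by blast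
  have 2: "f \<circ> G \<in> (\<Union>n. {f. f \<circ> H n \<in> Y n})" if "f \<in> (\<Union>n. F n)" for f
  proof -
    obtain n where "f \<in> F n" using \<open>f \<in> (\<Union>n. F n)\<close> by blast
    then have "f \<circ> G \<circ> H n \<in> Y n" using D(5)[of f n] by (simp add: comp_assoc GH)
    then show ?thesis by blast
  qed
  have 3: "inj G" "range G \<subseteq> A" using G D(3) by (auto simp: bij_betw_def G_def C_def)
  have 4: "(\<Union>n. F n) \<subseteq> cantor_points A" using D(1) by blast
  show "(\<Union>n. F n) \<in> lift_ideal I A"
    unfolding lift_ideal_def mem_Collect_eq
    by (intro conjI exI[of _ G] bexI[OF _ 1] ballI) (fact 4 3 2)+
qed

theorem cantor_algebra_boolean:
  assumes "sigma_ideal UNIV I" "index_invariant I" "infinite A"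
  shows "boolean_lattice (cantor_algebra I A)"
  unfolding cantor_algebra_def
  using quot_boolean[OF cantor_sets_sigma_algebra lift_ideal_sigma_ideal[OF assms]] .

end

(* For each index i, the ultrafilter contains exactly one of the two cylinders
   {h. h i = True} and {h. h i = False}; send a finite set d to the meet of the chosen cylinders
   over i in d. An element below infinitely many of the chosen cylinders is, modulo the ideal,
   contained in a set of functions prescribed on a countably infinite set of indices. This set lies
   in the lifted ideal because I contains the singletons, so the element is zero. *)

theory Submission
  imports Defs
begin

text \<open>For finite \<open>d\<close> this is a basic clopen cylinder. Infinite \<open>d\<close>
  is allowed as well, since those sets are the ones that fall into the lifted ideal. Only the values
  of \<epsilon> on \<open>d\<close> matter.\<close>

definition agreement_set :: "'k set \<Rightarrow> ('k \<Rightarrow> bool) \<Rightarrow> 'k set \<Rightarrow> ('k \<Rightarrow> bool) set" where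
  "agreement_set A \<epsilon> d = {h \<in> cantor_points A. \<forall>i\<in>d. h i = \<epsilon> i}"

lemma agreement_set_empty: "agreement_set A \<epsilon> {} = cantor_points A"
  by (simp add: agreement_set_def)

lemma agreement_set_insert:
  "agreement_set A \<epsilon> (insert i d) = agreement_set A \<epsilon> {i} \<inter> agreement_set A \<epsilon> d"
  by (auto simp: agreement_set_def)

lemma agreement_set_antimono: "d \<subseteq> d' \<Longrightarrow> agreement_set A \<epsilon> d' \<subseteq> agreement_set A \<epsilon> d"
  by (auto simp: agreement_set_def)

text \<open>The set is the preimage of a point of a discrete space under a coordinate projection,
  hence clopen and a generator of the \<sigma>-algebra.\<close>

lemma agreement_set_singleton_in_cantor_sets:
  assumes "i \<in> A"
  shows "agreement_set A \<epsilon> {i} \<in> cantor_sets A"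
proof -
  have cont: "continuous_map (cantor_space A) (discrete_topology UNIV) (\<lambda>h. h i)"
    unfolding cantor_space_def by (rule continuous_map_product_projection[OF assms])
  have eq: "agreement_set A \<epsilon> {i} = {h \<in> topspace (cantor_space A). h i \<in> {\<epsilon> i}}"
    by (auto simp: agreement_set_def cantor_space_def)
  have "openin (cantor_space A) (agreement_set A \<epsilon> {i})"
    unfolding eq by (rule openin_continuous_map_preimage[OF cont]) simp
  moreover have "closedin (cantor_space A) (agreement_set A \<epsilon> {i})"
    unfolding eq by (rule closedin_continuous_map_preimage[OF cont]) simp
  ultimately show ?thesis
    unfolding cantor_sets_def by (intro sigma_sets.Basic) simp
qed

lemma agreement_set_in_cantor_sets:
  assumes "finite d" "d \<subseteq> A"
  shows "agreement_set A \<epsilon> d \<in> cantor_sets A"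
proof -
  interpret sigma_algebra "cantor_points A" "cantor_sets A"
    by (rule cantor_sets_sigma_algebra)
  show ?thesis
    using assms
  proof (induction rule: finite_induct)
    case empty
    show ?case unfolding agreement_set_empty by (rule top)
  next
    case (insert i d)
    then show ?case
      unfolding agreement_set_insert[of A \<epsilon> i d]
      by (intro Int agreement_set_singleton_in_cantor_sets) auto
  qed
qed

text \<open>Enumerate a countably infinite part of \<open>d\<close> by an injective \<Delta>. Every
  member of the set, composed with \<Delta>, is the single point
  \<open>\<epsilon> \<circ> \<Delta>\<close>, so the singleton of that point witnesses
  membership.\<close>

lemma agreement_set_infinite_in_lift_ideal:
  assumes "\<And>x. {x} \<in> I" "infinite d" "d \<subseteq> A"
  shows "agreement_set A \<epsilon> d \<in> lift_ideal I A"
proof -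
  obtain \<Delta> :: "nat \<Rightarrow> 'a" where \<Delta>: "inj \<Delta>" "range \<Delta> \<subseteq> d"
    using assms(2) infinite_countable_subset by blast
  have "\<forall>f\<in>agreement_set A \<epsilon> d. f \<circ> \<Delta> \<in> {\<epsilon> \<circ> \<Delta>}"
    using \<Delta>(2) by (auto simp: agreement_set_def fun_eq_iff)
  then show ?thesis
    using \<Delta> assms(3) unfolding lift_ideal_def mem_Collect_eq
    by (intro conjI exI[of _ \<Delta>] bexI[OF _ assms(1)]) (auto simp: agreement_set_def)
qed

text \<open>Infinitely many such indices would yield an injective sequence of them, and countable
  additivity would put \<open>B\<close> into the ideal. This is what makes the Tukey map back to
  finite sets well defined.\<close>

lemma almost_contained_in_finitely_many:
  assumes I: "sigma_ideal UNIV I" "index_invariant I" "\<And>x. {x} \<in> I" and A: "infinite A"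
    and B: "B \<subseteq> cantor_points A" "B \<notin> lift_ideal I A"
  shows "finite {i \<in> A. B - agreement_set A \<epsilon> {i} \<in> lift_ideal I A}" (is "finite ?S")
proof (rule ccontr)
  assume "infinite ?S"
  then obtain \<Delta> :: "nat \<Rightarrow> 'a" where \<Delta>: "inj \<Delta>" "range \<Delta> \<subseteq> ?S"
    using infinite_countable_subset by blast
  note J = lift_ideal_sigma_ideal[OF I(1,2) A]
  have "range (\<lambda>n. B - agreement_set A \<epsilon> {\<Delta> n}) \<subseteq> lift_ideal I A"
    using \<Delta>(2) by blast
  then have "(\<Union>n. B - agreement_set A \<epsilon> {\<Delta> n}) \<in> lift_ideal I A"
    using J unfolding sigma_ideal_def by blast
  moreover have "agreement_set A \<epsilon> (range \<Delta>) \<in> lift_ideal I A"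
    using \<Delta> by (intro agreement_set_infinite_in_lift_ideal I(3) range_inj_infinite) auto
  ultimately have "(\<Union>n. B - agreement_set A \<epsilon> {\<Delta> n}) \<union> agreement_set A \<epsilon> (range \<Delta>)
      \<in> lift_ideal I A"
    by (rule sigma_ideal_Un[OF J])
  \<comment> \<open>A point of \<open>B\<close> either differs from \<epsilon> at some
    \<open>\<Delta> n\<close> or agrees with \<epsilon> on all of
    \<open>range \<Delta>\<close>.\<close>
  moreover have "B \<subseteq> (\<Union>n. B - agreement_set A \<epsilon> {\<Delta> n}) \<union> agreement_set A \<epsilon> (range \<Delta>)"
    using B(1) by (auto simp: agreement_set_def)
  ultimately show False
    using B(2) sigma_ideal_subset[OF J] by blast
qed

text \<open>The definition of an ultrafilter speaks of lattice complements; in the quotient, the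
  class of the set complement is one.\<close>

lemma ultrafilter_quot_compl:
  assumes M: "sigma_algebra \<Omega> M" and J: "sigma_ideal \<Omega> J"
    and U: "ultrafilter_on (quotient_algebra M J) U" and X: "X \<in> M"
  shows "quot_class M J X \<in> U \<or> quot_class M J (\<Omega> - X) \<in> U"
proof -
  interpret sigma_algebra \<Omega> M by (rule M)
  have "X \<union> (\<Omega> - X) = \<Omega>" using X sets_into_space by auto
  then have "is_complement (quotient_algebra M J) (quot_class M J X) (quot_class M J (\<Omega> - X))"
    using X by (simp add: is_complement_def quot_carrier[OF M J] quot_meet[OF M J]
        quot_join[OF M J] quot_bottom_eq[OF M J] quot_top_eq[OF M J] compl_sets
        del: Un_Diff_cancel)
  then show ?thesis using U unfolding ultrafilter_on_def by blast
qed

theorem theorem2p12: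
  fixes I :: "(nat \<Rightarrow> bool) set set" and \<kappa> :: "'k rel" and U :: "('k \<Rightarrow> bool) set set set"
  assumes "sigma_ideal UNIV I" and "index_invariant I" and "\<And>x. {x} \<in> I"
    and "Cinfinite \<kappa>"
    and "ultrafilter_on (cantor_algebra I (Field \<kappa>)) U"
  shows "tukey_le (Fpow (Field \<kappa>)) (\<subseteq>) U (\<lambda>a b. b \<sqsubseteq>\<^bsub>cantor_algebra I (Field \<kappa>)\<^esub> a)"
proof -
  define A where "A = Field \<kappa>"
  define M where "M = cantor_sets A"
  define J where "J = lift_ideal I A"
  have A: "infinite A" using assms(4) by (simp add: A_def cinfinite_def)
  have M: "sigma_algebra (cantor_points A) M"
    unfolding M_def by (rule cantor_sets_sigma_algebra)
  interpret sigma_algebra "cantor_points A" M by (rule M)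
  have J: "sigma_ideal (cantor_points A) J"
    unfolding J_def by (rule lift_ideal_sigma_ideal[OF assms(1,2) A])
  have U: "ultrafilter_on (quotient_algebra M J) U"
    using assms(5) by (simp add: cantor_algebra_def A_def M_def J_def)
  have carrier: "U \<subseteq> quot_class M J ` M"
    using U unfolding ultrafilter_on_def quot_carrier[OF M J] by (rule conjunct1)
  have top_U: "quot_class M J (cantor_points A) \<in> U" and bot: "quot_class M J {} \<notin> U"
    using U unfolding ultrafilter_on_def quot_top_eq[OF M J] quot_bottom_eq[OF M J] by simp_all
  have meet: "quot_class M J (X \<inter> Y) \<in> U"
    if "X \<in> M" "Y \<in> M" "quot_class M J X \<in> U" "quot_class M J Y \<in> U" for X Y
    using U that(3,4) unfolding ultrafilter_on_def quot_meet[OF M J that(1,2), symmetric] by simp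
  have "\<exists>\<epsilon>. \<forall>i\<in>A. quot_class M J (agreement_set A \<epsilon> {i}) \<in> U"
  proof -
    \<comment> \<open>The constant function \<open>\<lambda>_. b\<close> isolates the choice at the
      one index \<open>i\<close>. The separate choices then glue to one \<epsilon>, because a
      cylinder over \<open>{i}\<close> depends only on the value at \<open>i\<close>.\<close>
    have "\<exists>b. quot_class M J (agreement_set A (\<lambda>_. b) {i}) \<in> U" if i: "i \<in> A" for i
    proof -
      have compl: "cantor_points A - agreement_set A (\<lambda>_. True) {i} = agreement_set A (\<lambda>_. False) {i}"
        by (auto simp: agreement_set_def)
      show ?thesis
        using ultrafilter_quot_compl[OF M J U, of "agreement_set A (\<lambda>_. True) {i}"]
          agreement_set_singleton_in_cantor_sets[OF i, of "\<lambda>_. True"]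
        unfolding compl M_def by blast
    qed
    then obtain \<epsilon> where "\<forall>i\<in>A. quot_class M J (agreement_set A (\<lambda>_. \<epsilon> i) {i}) \<in> U"
      by metis
    then show ?thesis by (auto simp: agreement_set_def)
  qed
  then obtain \<epsilon> where \<epsilon>: "\<And>i. i \<in> A \<Longrightarrow> quot_class M J (agreement_set A \<epsilon> {i}) \<in> U"
    by blast
  have in_M: "agreement_set A \<epsilon> d \<in> M" if "finite d" "d \<subseteq> A" for d
    unfolding M_def using that by (rule agreement_set_in_cantor_sets)
  have in_U: "quot_class M J (agreement_set A \<epsilon> d) \<in> U" if "finite d" "d \<subseteq> A" for d
    using that
  proof (induction rule: finite_induct)
    case empty
    show ?case unfolding agreement_set_empty by (rule top_U)
  next
    case (insert i d)
    then show ?case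
      unfolding agreement_set_insert[of A \<epsilon> i d] by (intro meet in_M \<epsilon>) auto
  qed
  define f where "f d = quot_class M J (agreement_set A \<epsilon> d)" for d
  \<comment> \<open>The set \<open>g e\<close> collects every index whose chosen cylinder lies above
    \<open>e\<close>. It therefore contains each finite \<open>d\<close> with \<open>e\<close> below
    \<open>f d\<close>; what needs proof is that it is finite.\<close>
  define g where "g e = {i \<in> A. e \<sqsubseteq>\<^bsub>quotient_algebra M J\<^esub> f {i}}" for e
  have g_iff: "i \<in> g (quot_class M J B) \<longleftrightarrow> i \<in> A \<and> B - agreement_set A \<epsilon> {i} \<in> J"
    if "B \<in> M" for B i
    using quot_le_iff[OF M J that in_M[of "{i}"]] by (auto simp: g_def f_def)
  have "f \<in> Fpow A \<rightarrow> U" using in_U by (auto simp: f_def Fpow_def)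
  moreover have "g \<in> U \<rightarrow> Fpow A"
  proof
    fix e assume e: "e \<in> U"
    then obtain B where B: "B \<in> M" "e = quot_class M J B" using carrier by blast
    have sub: "B \<subseteq> cantor_points A"
      by (rule sets_into_space[OF B(1)])
    \<comment> \<open>If \<open>B\<close> were in the ideal, its class would be the bottom element,
      which no ultrafilter contains.\<close>
    then have "B \<notin> J"
      using quot_eq_iff[OF M J B(1) empty_sets] e bot B(2) J by (auto simp: sigma_ideal_def)
    then have "finite {i \<in> A. B - agreement_set A \<epsilon> {i} \<in> J}"
      using almost_contained_in_finitely_many[OF assms(1-3) A sub] unfolding J_def by blast
    then have "finite (g e)" using g_iff[OF B(1)] unfolding B(2)
      by (auto intro: rev_finite_subset)
    then show "g e \<in> Fpow A" by (auto simp: Fpow_def g_def)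
  qed
  moreover have "d \<subseteq> g e"
    if d: "d \<in> Fpow A" and e: "e \<in> U" and le: "e \<sqsubseteq>\<^bsub>quotient_algebra M J\<^esub> f d" for d e
  proof
    fix i assume i: "i \<in> d"
    from e obtain B where B: "B \<in> M" "e = quot_class M J B" using carrier by blast
    have "B - agreement_set A \<epsilon> d \<in> J"
      using le quot_le_iff[OF M J B(1) in_M[of d]] d by (simp add: B(2) f_def Fpow_def)
    \<comment> \<open>The cylinder over \<open>d\<close> lies inside the one over
      \<open>{i}\<close>, so removing the latter from \<open>B\<close> leaves less.\<close>
    moreover have "B - agreement_set A \<epsilon> {i} \<subseteq> B - agreement_set A \<epsilon> d"
      using agreement_set_antimono[of "{i}" d A \<epsilon>] i by blast
    ultimately have "B - agreement_set A \<epsilon> {i} \<in> J" by (rule sigma_ideal_subset[OF J])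
    then show "i \<in> g e" using g_iff[OF B(1)] i d by (auto simp: B(2) Fpow_def)
  qed
  ultimately have "tukey_le (Fpow A) (\<subseteq>) U (\<lambda>a b. b \<sqsubseteq>\<^bsub>quotient_algebra M J\<^esub> a)"
    unfolding tukey_le_def by (intro bexI[of _ f] bexI[of _ g]) simp_all
  then show ?thesis by (simp add: cantor_algebra_def A_def M_def J_def)
qed

end
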